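(* Let $G_1$ and $G_2$ be looped simple graphs. The following are equivalent: (1) up to isomorphism, $G_2$ can be obtained from $G_1$ using local complementations (simple or non-simple) and loop complementations; (2) there is a compatible isomorphism $\beta:M(IAS(G_1))\to M(IAS(G_2))$.
   Context: A looped simple graph is a finite graph in which each vertex may carry at most one loop and distinct non-loop edges join distinct pairs of vertices; $N(v)$ is the open neighborhood (set of neighbors other than $v$). $A(G)$ is the adjacency matrix over $GF(2)$ (diagonal entry $1$ iff looped, off-diagonal $1$ iff adjacent). $IAS(G)=(I\mid A(G)\mid I+A(G))$ over $GF(2)$ represents the binary matroid $M(IAS(G))$ on ground set $W(G)$ of its columns; for $v\in V(G)$, $v_\phi,v_\chi,v_\psi$ are the columns of $v$ in $I$, $A(G)$, $I+A(G)$. The canonical partition of $W(G)$ has cells $\{v_\phi,v_\chi,v_\psi\}$. A compatible isomorphism is a matroid isomorphism $\beta:M(IAS(G_1))\to M(IAS(G_2))$ mapping canonical cells onto canonical cells. Loop complementation at $v$ reverses the loop status of $v$. The simple local complement $G^v_s$ complements all adjacencies between distinct elements of $N(v)$; the non-simple local complement $G^v_{ns}$ is obtained from $G^v_s$ by also reversing the loop status of every element of $N(v)$. *)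

theory Defs
  imports Complex_Main "HOL-Library.Z2" "HOL-Library.Function_Algebras"
begin

text \<open>An edge is the set of its end-vertices: \<open>{v}\<close> is the loop at \<open>v\<close>, and \<open>{v, w}\<close> with
  \<open>v \<noteq> w\<close> is a non-loop edge. As the edges form a set, there are no parallel loops or edges.\<close>

record 'a looped_graph =
  verts :: "'a set"
  edges :: "'a set set"

locale looped_simple_graph =
  fixes G :: "'a looped_graph"
  assumes finite_verts: "finite (verts G)"
    and edges_subset: "edges G \<subseteq> {{v, w} | v w. v \<in> verts G \<and> w \<in> verts G}"

definition open_nbhd :: "'a looped_graph \<Rightarrow> 'a \<Rightarrow> 'a set" where
  "open_nbhd G v = {w \<in> verts G. w \<noteq> v \<and> {v, w} \<in> edges G}"

definition loop_complement :: "'a looped_graph \<Rightarrow> 'a \<Rightarrow> 'a looped_graph" where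
  "loop_complement G v = G\<lparr>edges := sym_diff (edges G) {{v}}\<rparr>"

definition simple_local_complement :: "'a looped_graph \<Rightarrow> 'a \<Rightarrow> 'a looped_graph" where
  "simple_local_complement G v = G\<lparr>edges := sym_diff (edges G)
     {{x, y} | x y. x \<in> open_nbhd G v \<and> y \<in> open_nbhd G v \<and> x \<noteq> y}\<rparr>"

definition nonsimple_local_complement :: "'a looped_graph \<Rightarrow> 'a \<Rightarrow> 'a looped_graph" where
  "nonsimple_local_complement G v = (let H = simple_local_complement G v in
     H\<lparr>edges := sym_diff (edges H) {{x} | x. x \<in> open_nbhd G v}\<rparr>)"

inductive obtainable :: "'a looped_graph \<Rightarrow> 'a looped_graph \<Rightarrow> bool" for G where
  obtainable_refl: "obtainable G G"
| obtainable_loop: "obtainable G H \<Longrightarrow> v \<in> verts H \<Longrightarrow> obtainable G (loop_complement H v)"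
| obtainable_simple:
    "obtainable G H \<Longrightarrow> v \<in> verts H \<Longrightarrow> obtainable G (simple_local_complement H v)"
| obtainable_nonsimple:
    "obtainable G H \<Longrightarrow> v \<in> verts H \<Longrightarrow> obtainable G (nonsimple_local_complement H v)"

text \<open>The case \<open>v = w\<close> says that isomorphisms preserve loops in both directions.\<close>

definition graph_isomorphism ::
    "'a looped_graph \<Rightarrow> 'b looped_graph \<Rightarrow> ('a \<Rightarrow> 'b) \<Rightarrow> bool" where
  "graph_isomorphism G H f \<longleftrightarrow> bij_betw f (verts G) (verts H) \<and>
     (\<forall>v\<in>verts G. \<forall>w\<in>verts G. {v, w} \<in> edges G \<longleftrightarrow> {f v, f w} \<in> edges H)"

definition isomorphic_graphs :: "'a looped_graph \<Rightarrow> 'b looped_graph \<Rightarrow> bool" where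
  "isomorphic_graphs G H \<longleftrightarrow> (\<exists>f. graph_isomorphism G H f)"


record 'e matroid =
  ground :: "'e set"
  indep_sets :: "'e set set"

locale is_matroid =
  fixes M :: "'e matroid"
  assumes finite_ground: "finite (ground M)"
    and indep_subset_ground: "X \<in> indep_sets M \<Longrightarrow> X \<subseteq> ground M"
    and empty_indep: "{} \<in> indep_sets M"
    and indep_mono: "X \<in> indep_sets M \<Longrightarrow> Y \<subseteq> X \<Longrightarrow> Y \<in> indep_sets M"
    and augmentation: "X \<in> indep_sets M \<Longrightarrow> Y \<in> indep_sets M \<Longrightarrow> card X < card Y \<Longrightarrow>
      \<exists>e\<in>Y - X. insert e X \<in> indep_sets M"

definition matroid_isomorphism :: "'e matroid \<Rightarrow> 'f matroid \<Rightarrow> ('e \<Rightarrow> 'f) \<Rightarrow> bool" where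
  "matroid_isomorphism M N \<beta> \<longleftrightarrow> bij_betw \<beta> (ground M) (ground N) \<and>
     (\<forall>X\<subseteq>ground M. X \<in> indep_sets M \<longleftrightarrow> \<beta> ` X \<in> indep_sets N)"

text \<open>A matrix with row labels \<open>R\<close> and column labels \<open>E\<close> is a function \<open>A\<close> of a row label and a
  column label. Independence is that of the family of columns labelled by \<open>X\<close>, so that distinct
  labels carrying equal columns are parallel elements of the matroid.\<close>

definition columns_independent :: "'r set \<Rightarrow> ('r \<Rightarrow> 'e \<Rightarrow> 'k::field) \<Rightarrow> 'e set \<Rightarrow> bool" where
  "columns_independent R A X \<longleftrightarrow>
     (\<forall>c. (\<forall>i\<in>R. (\<Sum>e\<in>X. c e * A i e) = 0) \<longrightarrow> (\<forall>e\<in>X. c e = 0))"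

definition represented_matroid ::
    "'r set \<Rightarrow> 'e set \<Rightarrow> ('r \<Rightarrow> 'e \<Rightarrow> 'k::field) \<Rightarrow> 'e matroid" where
  "represented_matroid R E A =
     \<lparr>ground = E, indep_sets = {X. X \<subseteq> E \<and> columns_independent R A X}\<rparr>"

text \<open>The following lemmas justify the two definitions above: they agree with the library's linear
  independence, and the result satisfies the matroid axioms.\<close>

definition fun_scale :: "'k::field \<Rightarrow> ('r \<Rightarrow> 'k) \<Rightarrow> 'r \<Rightarrow> 'k" where
  "fun_scale c f = (\<lambda>i. c * f i)"

interpretation fun_space: vector_space fun_scale
  by unfold_locales (auto simp: fun_scale_def fun_eq_iff algebra_simps)

definition column :: "'r set \<Rightarrow> ('r \<Rightarrow> 'e \<Rightarrow> 'k::field) \<Rightarrow> 'e \<Rightarrow> 'r \<Rightarrow> 'k" where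
  "column R A e = (\<lambda>i. if i \<in> R then A i e else 0)"

lemma sum_column_eq_0_iff:
  "(\<Sum>e\<in>X. fun_scale (c e) (column R A e)) = 0 \<longleftrightarrow> (\<forall>i\<in>R. (\<Sum>e\<in>X. c e * A i e) = 0)"
proof -
  have "(\<Sum>e\<in>X. fun_scale (c e) (column R A e)) i = (if i \<in> R then \<Sum>e\<in>X. c e * A i e else 0)" for i
    by (induction X rule: infinite_finite_induct) (auto simp: fun_scale_def column_def)
  then show ?thesis
    by (auto simp: fun_eq_iff)
qed

lemma columns_independent_iff:
  assumes "finite X"
  shows "columns_independent R A X \<longleftrightarrow>
    inj_on (column R A) X \<and> fun_space.independent (column R A ` X)"
proof
  assume ind: "columns_independent R A X"
  then have *: "e \<in> X \<Longrightarrow> c e = 0"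
    if "(\<Sum>e\<in>X. fun_scale (c e) (column R A e)) = 0" for c e
    using that unfolding columns_independent_def sum_column_eq_0_iff by blast
  have inj: "inj_on (column R A) X"
  proof (rule inj_onI, rule ccontr)
    fix e f assume ef: "e \<in> X" "f \<in> X" "column R A e = column R A f" "e \<noteq> f"
    define c where "c g = (if g = e then 1 else if g = f then -1 else 0 :: 'c)" for g
    have "(\<Sum>g\<in>X. fun_scale (c g) (column R A g))
        = (\<Sum>g\<in>{e, f}. fun_scale (c g) (column R A g))"
      using ef assms by (intro sum.mono_neutral_right) (auto simp: c_def fun_scale_def fun_eq_iff)
    also have "\<dots> = 0"
      using ef by (auto simp: c_def fun_scale_def fun_eq_iff)
    finally show False
      using *[of c e] ef by (simp add: c_def)
  qed
  moreover have "fun_space.independent (column R A ` X)"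
    unfolding fun_space.dependent_finite[OF finite_imageI[OF assms]]
  proof safe
    fix u e assume "(\<Sum>v\<in>column R A ` X. fun_scale (u v) v) = 0" "e \<in> X" "u (column R A e) \<noteq> 0"
    then show False
      using *[of "\<lambda>e. u (column R A e)" e] by (simp add: sum.reindex[OF inj])
  qed
  ultimately show "inj_on (column R A) X \<and> fun_space.independent (column R A ` X)" ..
next
  assume r: "inj_on (column R A) X \<and> fun_space.independent (column R A ` X)"
  show "columns_independent R A X"
    unfolding columns_independent_def sum_column_eq_0_iff[symmetric]
  proof (intro allI impI ballI)
    fix c e assume c: "(\<Sum>e\<in>X. fun_scale (c e) (column R A e)) = 0" and e: "e \<in> X"
    let ?u = "c \<circ> the_inv_into X (column R A)"
    have "(\<Sum>v\<in>column R A ` X. fun_scale (?u v) v) = (\<Sum>e\<in>X. fun_scale (c e) (column R A e))"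
      using r by (auto simp: sum.reindex the_inv_into_f_f intro!: sum.cong)
    then have "?u (column R A e) = 0"
      using r c e unfolding fun_space.dependent_finite[OF finite_imageI[OF assms]] by auto
    then show "c e = 0"
      using r e by (simp add: the_inv_into_f_f)
  qed
qed

lemma is_matroid_represented:
  assumes "finite E"
  shows "is_matroid (represented_matroid R E A)"
proof
  fix X Y
  assume "X \<in> indep_sets (represented_matroid R E A)"
    "Y \<in> indep_sets (represented_matroid R E A)" and card: "card X < card Y"
  then have X: "X \<subseteq> E" "finite X" "inj_on (column R A) X" "fun_space.independent (column R A ` X)"
    and Y: "Y \<subseteq> E" "finite Y" "inj_on (column R A) Y" "fun_space.independent (column R A ` Y)"
    using assms finite_subset
    by (auto simp: represented_matroid_def columns_independent_iff dest: finite_subset)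
  have "\<not> column R A ` Y \<subseteq> fun_space.span (column R A ` X)"
    using fun_space.independent_span_bound[of "column R A ` X" "column R A ` Y"] X Y card
    by (auto simp: card_image)
  then obtain e where e: "e \<in> Y" "column R A e \<notin> fun_space.span (column R A ` X)"
    by auto
  then have n: "column R A e \<notin> column R A ` X"
    using fun_space.span_base by blast
  then have "columns_independent R A (insert e X)"
    using X e fun_space.independent_insertI[OF e(2) X(4)]
    by (subst columns_independent_iff) auto
  then show "\<exists>e\<in>Y - X. insert e X \<in> indep_sets (represented_matroid R E A)"
    using X Y e n by (intro bexI[of _ e]) (auto simp: represented_matroid_def)
next
  fix X Y
  assume "X \<in> indep_sets (represented_matroid R E A)" and "Y \<subseteq> X"
  then show "Y \<in> indep_sets (represented_matroid R E A)"
    using assms fun_space.independent_mono[OF _ image_mono[of Y X "column R A"]]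
    by (auto simp: represented_matroid_def columns_independent_iff finite_subset
        intro: inj_on_subset)
qed (use assms in \<open>auto simp: represented_matroid_def columns_independent_def\<close>)


definition adjacency_matrix :: "'a looped_graph \<Rightarrow> 'a \<Rightarrow> 'a \<Rightarrow> bit" where
  "adjacency_matrix G v w = of_bool ({v, w} \<in> edges G)"

definition identity_matrix :: "'a \<Rightarrow> 'a \<Rightarrow> bit" where
  "identity_matrix v w = of_bool (v = w)"

datatype column_kind = Phi | Chi | Psi

fun IAS :: "'a looped_graph \<Rightarrow> 'a \<Rightarrow> 'a \<times> column_kind \<Rightarrow> bit" where
  "IAS G i (v, Phi) = identity_matrix i v"
| "IAS G i (v, Chi) = adjacency_matrix G i v"
| "IAS G i (v, Psi) = identity_matrix i v + adjacency_matrix G i v"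

definition IAS_ground :: "'a looped_graph \<Rightarrow> ('a \<times> column_kind) set" where
  "IAS_ground G = {(v, k). v \<in> verts G}"

definition IAS_matroid :: "'a looped_graph \<Rightarrow> ('a \<times> column_kind) matroid" where
  "IAS_matroid G = represented_matroid (verts G) (IAS_ground G) (IAS G)"

definition canonical_partition :: "'a looped_graph \<Rightarrow> ('a \<times> column_kind) set set" where
  "canonical_partition G = {{(v, Phi), (v, Chi), (v, Psi)} | v. v \<in> verts G}"

definition compatible_isomorphism ::
    "'a looped_graph \<Rightarrow> 'b looped_graph \<Rightarrow> ('a \<times> column_kind \<Rightarrow> 'b \<times> column_kind) \<Rightarrow> bool" where
  "compatible_isomorphism G H \<beta> \<longleftrightarrow>
     matroid_isomorphism (IAS_matroid G) (IAS_matroid H) \<beta> \<and>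
     (\<forall>C\<in>canonical_partition G. \<beta> ` C \<in> canonical_partition H)"

end

theory Submission
  imports Defs "HOL-Combinatorics.Transposition"
begin

text \<open>For each graph operation there is a compatible isomorphism: loop complementation at \<open>v\<close>
  exchanges \<open>v\<^sub>\<chi>\<close> and \<open>v\<^sub>\<psi>\<close>, and non-simple local complementation at \<open>v\<close> amounts to adding row \<open>v\<close>
  to the rows of \<open>N(v)\<close>, which exchanges \<open>v\<^sub>\<phi>\<close> with the column of \<open>v\<close> whose own entry is \<open>1\<close>.

  Conversely, given \<open>\<beta>\<close>, let \<open>D\<close> be the set of vertices \<open>v\<close> such that the column \<open>\<tau>\<^sub>v\<close> of \<open>v\<close> sent
  by \<open>\<beta>\<close> to a \<open>\<phi>\<close>-column is not \<open>v\<^sub>\<phi>\<close>. If \<open>\<tau>\<^sub>v\<close> has entry \<open>1\<close> in row \<open>v\<close> for some \<open>v \<in> D\<close>, a local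
  complementation at \<open>v\<close> removes \<open>v\<close> from \<open>D\<close>. Otherwise independence of the preimage of the
  \<open>\<phi>\<close>-columns gives adjacent \<open>v, w \<in> D\<close>, and a local complementation at \<open>v\<close> makes \<open>w\<close> removable.
  Once \<open>D\<close> is empty the two graphs agree up to loops, because fundamental circuits with respect to
  the \<open>\<phi>\<close>-columns determine the adjacencies.\<close>

section \<open>Local complementation\<close>

lemma open_nbhd_iff: "w \<in> open_nbhd G v \<longleftrightarrow> w \<in> verts G \<and> w \<noteq> v \<and> {v, w} \<in> edges G"
  by (auto simp: open_nbhd_def)

lemma verts_operations [simp]:
  "verts (loop_complement G v) = verts G"
  "verts (simple_local_complement G v) = verts G"
  "verts (nonsimple_local_complement G v) = verts G"
  by (auto simp: loop_complement_def simple_local_complement_def nonsimple_local_complement_def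
      Let_def)

lemma edge_loop_complement:
  "x \<noteq> y \<Longrightarrow> {x, y} \<in> edges (loop_complement G v) \<longleftrightarrow> {x, y} \<in> edges G"
  by (auto simp: loop_complement_def doubleton_eq_iff)

text \<open>The loop reversals are the pairs with \<open>x = y\<close>. They are disjoint from the
  proper pairs, so two successive symmetric differences merge into one.\<close>

lemma edges_nonsimple_local_complement:
  "edges (nonsimple_local_complement G v) =
    sym_diff (edges G) {{x, y} | x y. x \<in> open_nbhd G v \<and> y \<in> open_nbhd G v}"
proof -
  let ?N = "open_nbhd G v"
  have *: "{{x, y} | x y. x \<in> ?N \<and> y \<in> ?N} =
      {{x, y} | x y. x \<in> ?N \<and> y \<in> ?N \<and> x \<noteq> y} \<union> {{x} | x. x \<in> ?N}"
    by blast
  have "{{x, y} | x y. x \<in> ?N \<and> y \<in> ?N \<and> x \<noteq> y} \<inter> {{x} | x. x \<in> ?N} = {}"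
    by (auto simp: doubleton_eq_iff)
  then show ?thesis
    unfolding nonsimple_local_complement_def simple_local_complement_def Let_def * by auto
qed

lemma edge_nonsimple_local_complement:
  "{x, y} \<in> edges (nonsimple_local_complement G v) \<longleftrightarrow>
    ({x, y} \<in> edges G) \<noteq> (x \<in> open_nbhd G v \<and> y \<in> open_nbhd G v)"
  unfolding edges_nonsimple_local_complement by (auto simp: doubleton_eq_iff)

lemma edge_simple_local_complement:
  assumes "x \<noteq> y"
  shows "{x, y} \<in> edges (simple_local_complement G v) \<longleftrightarrow>
    {x, y} \<in> edges (nonsimple_local_complement G v)"
  using assms unfolding nonsimple_local_complement_def by (auto simp: Let_def doubleton_eq_iff)

lemma open_nbhd_nonsimple_local_complement [simp]:
  "open_nbhd (nonsimple_local_complement G v) v = open_nbhd G v"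
  by (auto simp: open_nbhd_def edge_nonsimple_local_complement)

text \<open>The neighborhood of \<open>v\<close> survives the operation, so the same set of pairs is
  toggled twice.\<close>

lemma nonsimple_local_complement_involution:
  "nonsimple_local_complement (nonsimple_local_complement G v) v = G"
proof -
  have "edges (nonsimple_local_complement (nonsimple_local_complement G v) v) = edges G"
    by (auto simp: edges_nonsimple_local_complement[of "nonsimple_local_complement G v"]
        edges_nonsimple_local_complement[of G])
  then show ?thesis
    by (simp add: nonsimple_local_complement_def simple_local_complement_def Let_def)
qed

lemma obtainable_trans: "obtainable H K \<Longrightarrow> obtainable G H \<Longrightarrow> obtainable G K"
  by (induction rule: obtainable.induct) (auto intro: obtainable.intros)

lemma obtainable_loop_complements:
  assumes "finite S" "S \<subseteq> verts G"
  shows "obtainable G (G\<lparr>edges := sym_diff (edges G) {{v} | v. v \<in> S}\<rparr>)"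
  using assms
proof (induction S rule: finite_induct)
  case empty
  then show ?case by (simp add: obtainable_refl)
next
  case (insert v S)
  let ?H = "G\<lparr>edges := sym_diff (edges G) {{v} | v. v \<in> S}\<rparr>"
  have "obtainable G (loop_complement ?H v)"
    using insert by (intro obtainable_loop) auto
  moreover have "sym_diff (sym_diff (edges G) {{w} | w. w \<in> S}) {{v}} =
      sym_diff (edges G) {{w} | w. w \<in> insert v S}"
    using insert.hyps by auto
  then have "loop_complement ?H v =
      G\<lparr>edges := sym_diff (edges G) {{w} | w. w \<in> insert v S}\<rparr>"
    unfolding loop_complement_def by simp
  ultimately show ?case by simp
qed

text \<open>The change is a rank-one update, by the outer square of the indicator vector of the
  neighborhood.\<close>

lemma adjacency_matrix_nonsimple_local_complement:
  "adjacency_matrix (nonsimple_local_complement G v) x y =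
    adjacency_matrix G x y + of_bool (x \<in> open_nbhd G v) * of_bool (y \<in> open_nbhd G v)"
  by (auto simp: adjacency_matrix_def edge_nonsimple_local_complement)

lemma UNIV_column_kind: "UNIV = {Phi, Chi, Psi}"
  using column_kind.exhaust by auto

lemma IAS_ground_eq: "IAS_ground G = verts G \<times> UNIV"
  by (auto simp: IAS_ground_def)

lemma canonical_partition_eq: "canonical_partition G = (\<lambda>v. {v} \<times> UNIV) ` verts G"
  by (auto simp: canonical_partition_def UNIV_column_kind)

section \<open>Compatible isomorphisms from row operations\<close>

text \<open>Independence depends only on the space of linear dependencies. The second assumption
  compares these spaces with all coefficients indexed by \<open>X\<close>, a form in which row
  operations are easy to follow.\<close>

lemma columns_independent_reindex:
  assumes "inj_on g X"
    and "\<And>c. (\<forall>i\<in>R. (\<Sum>e\<in>X. c e * A i e) = 0) \<longleftrightarrow> (\<forall>i\<in>R'. (\<Sum>e\<in>X. c e * A' i (g e)) = 0)"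
  shows "columns_independent R A X \<longleftrightarrow> columns_independent R' A' (g ` X)"
proof -
  let ?dep = "\<lambda>c. \<forall>i\<in>R'. (\<Sum>e\<in>X. c e * A' i (g e)) = 0"
  have "(\<forall>c. ?dep c \<longrightarrow> (\<forall>e\<in>X. c e = 0)) \<longleftrightarrow>
      (\<forall>c. ?dep (c \<circ> g) \<longrightarrow> (\<forall>e\<in>X. (c \<circ> g) e = 0))"
  proof (intro iffI allI)
    fix c assume "\<forall>c. ?dep c \<longrightarrow> (\<forall>e\<in>X. c e = 0)"
    then show "?dep (c \<circ> g) \<longrightarrow> (\<forall>e\<in>X. (c \<circ> g) e = 0)"
      by (rule spec)
  next
    fix c assume *: "\<forall>c. ?dep (c \<circ> g) \<longrightarrow> (\<forall>e\<in>X. (c \<circ> g) e = 0)"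
    show "?dep c \<longrightarrow> (\<forall>e\<in>X. c e = 0)"
    proof
      assume c: "?dep c"
      \<comment> \<open>As \<open>g\<close> is injective on \<open>X\<close>, every coefficient
        function agrees on \<open>X\<close> with one that factors through \<open>g\<close>.\<close>
      let ?c = "c \<circ> the_inv_into X g"
      have eq: "(?c \<circ> g) e = c e" if "e \<in> X" for e
        using that assms(1) by (simp add: the_inv_into_f_f)
      have "?dep (?c \<circ> g)"
        using c eq by (simp cong: sum.cong)
      with spec[OF *, of ?c] have "\<forall>e\<in>X. (?c \<circ> g) e = 0"
        by (rule mp)
      then show "\<forall>e\<in>X. c e = 0"
        using eq by simp
    qed
  qed
  then show ?thesis
    unfolding columns_independent_def by (simp add: assms(2) sum.reindex[OF assms(1)])
qed

lemma compatible_isomorphismI: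
  assumes f: "bij_betw f (verts G) (verts H)"
    and p: "\<And>v. v \<in> verts G \<Longrightarrow> bij (p v)"
    and rows: "\<And>c X. X \<subseteq> IAS_ground G \<Longrightarrow> (\<forall>i\<in>verts G. (\<Sum>e\<in>X. c e * IAS G i e) = 0) \<longleftrightarrow>
      (\<forall>i\<in>verts H. (\<Sum>e\<in>X. c e * IAS H i (f (fst e), p (fst e) (snd e))) = 0)"
  shows "compatible_isomorphism G H (\<lambda>e. (f (fst e), p (fst e) (snd e)))"
proof -
  let ?g = "\<lambda>e. (f (fst e), p (fst e) (snd e))"
  have cell: "?g ` ({v} \<times> UNIV) = {f v} \<times> UNIV" if "v \<in> verts G" for v
  proof -
    have "?g ` ({v} \<times> UNIV) = {f v} \<times> range (p v)"
      by (force simp: image_iff)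
    then show ?thesis
      using p[OF that] by (simp add: bij_def)
  qed
  have inj: "inj_on ?g (IAS_ground G)"
  proof (rule inj_onI)
    fix e e' assume e: "e \<in> IAS_ground G" "e' \<in> IAS_ground G" "?g e = ?g e'"
    then have "fst e = fst e'"
      using f by (auto simp: IAS_ground_eq bij_betw_def dest: inj_onD)
    then show "e = e'"
      using e p[of "fst e"] by (auto simp: IAS_ground_eq bij_def prod_eq_iff dest: injD)
  qed
  have "?g ` IAS_ground G = (\<Union>v\<in>verts G. ?g ` ({v} \<times> UNIV))"
    by (auto simp: IAS_ground_eq)
  also have "\<dots> = f ` verts G \<times> UNIV"
    using cell by auto
  finally have "bij_betw ?g (IAS_ground G) (IAS_ground H)"
    using inj f by (simp add: bij_betw_def IAS_ground_eq)
  moreover have "columns_independent (verts G) (IAS G) X \<longleftrightarrow>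
      columns_independent (verts H) (IAS H) (?g ` X)" if "X \<subseteq> IAS_ground G" for X
    using columns_independent_reindex[OF inj_on_subset[OF inj that] rows[OF that]] .
  ultimately have "matroid_isomorphism (IAS_matroid G) (IAS_matroid H) ?g"
    by (auto simp: matroid_isomorphism_def IAS_matroid_def represented_matroid_def bij_betw_def)
  then show ?thesis
    using cell f
    by (auto simp: compatible_isomorphism_def canonical_partition_eq bij_betw_def)
qed

lemma compatible_isomorphism_trans:
  assumes "compatible_isomorphism G H \<alpha>" "compatible_isomorphism H K \<beta>"
  shows "compatible_isomorphism G K (\<beta> \<circ> \<alpha>)"
proof -
  have "\<alpha> ` X \<subseteq> ground (IAS_matroid H)" if "X \<subseteq> ground (IAS_matroid G)" for X
    using assms(1) that
    by (auto simp: compatible_isomorphism_def matroid_isomorphism_def bij_betw_def)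
  moreover have "(\<beta> \<circ> \<alpha>) ` C \<in> canonical_partition K" if "C \<in> canonical_partition G" for C
    unfolding image_comp[symmetric] using assms that by (simp add: compatible_isomorphism_def)
  ultimately show ?thesis
    using assms by (auto simp: compatible_isomorphism_def matroid_isomorphism_def image_image
        intro: bij_betw_trans)
qed

text \<open>Over GF(2), reversing the loop at \<open>v\<close> adds 1 to one diagonal entry and so
  exchanges the columns \<open>Chi\<close> and \<open>Psi\<close> of \<open>v\<close>. The
  permutation \<open>p\<close> undoes this wherever the loops disagree.\<close>

lemma compatible_isomorphism_off_diagonal:
  assumes f: "bij_betw f (verts G) (verts H)"
    and adj: "\<And>v w. v \<in> verts G \<Longrightarrow> w \<in> verts G \<Longrightarrow> v \<noteq> w \<Longrightarrow>
      {v, w} \<in> edges G \<longleftrightarrow> {f v, f w} \<in> edges H"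
  shows "\<exists>\<beta>. compatible_isomorphism G H \<beta>"
proof -
  define p where
    "p v = (if {v} \<in> edges G \<longleftrightarrow> {f v} \<in> edges H then id else transpose Chi Psi)" for v
  have eq: "IAS H (f i) (f v, p v k) = IAS G i (v, k)" if "i \<in> verts G" "v \<in> verts G" for i v k
  proof (cases "i = v")
    case True
    then show ?thesis
      by (cases k) (auto simp: p_def adjacency_matrix_def identity_matrix_def)
  next
    case False
    moreover from False have "f i \<noteq> f v"
      using f that by (auto simp: bij_betw_def inj_on_def)
    ultimately show ?thesis
      using adj[of i v] that by (cases k) (auto simp: p_def adjacency_matrix_def identity_matrix_def)
  qed
  have "compatible_isomorphism G H (\<lambda>e. (f (fst e), p (fst e) (snd e)))"
  proof (rule compatible_isomorphismI[OF f])
    fix c :: "'a \<times> column_kind \<Rightarrow> bit" and X assume "X \<subseteq> IAS_ground G"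
    then have "(\<Sum>e\<in>X. c e * IAS H (f i) (f (fst e), p (fst e) (snd e))) =
        (\<Sum>e\<in>X. c e * IAS G i e)" if "i \<in> verts G" for i
      using that by (intro sum.cong) (auto simp: IAS_ground_eq eq)
    moreover have "verts H = f ` verts G"
      using f by (simp add: bij_betw_def)
    ultimately show "(\<forall>i\<in>verts G. (\<Sum>e\<in>X. c e * IAS G i e) = 0) \<longleftrightarrow>
        (\<forall>i\<in>verts H. (\<Sum>e\<in>X. c e * IAS H i (f (fst e), p (fst e) (snd e))) = 0)"
      by simp
  qed (auto simp: p_def)
  then show ?thesis by blast
qed

text \<open>This is the one column of \<open>v\<close> besides \<open>Phi\<close> that has entry 1
  in row \<open>v\<close>, so that a pivot on it is possible.\<close>

definition pivot_kind :: "'a looped_graph \<Rightarrow> 'a \<Rightarrow> column_kind" where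
  "pivot_kind G v = (if {v} \<in> edges G then Chi else Psi)"

definition pivot_map :: "'a looped_graph \<Rightarrow> 'a \<Rightarrow> 'a \<times> column_kind \<Rightarrow> 'a \<times> column_kind" where
  "pivot_map G v e =
    (fst e, (if fst e = v then transpose Phi (pivot_kind G v) else id) (snd e))"

text \<open>The right-hand side is the matrix after row \<open>v\<close> has been added to the rows
  of its neighbors. For \<open>w = v\<close> this clears the pivot column to the unit vector, turns
  \<open>Phi\<close> into the old pivot column and leaves the third column alone, its entry in row
  \<open>v\<close> being 0. For \<open>w\<close> other than \<open>v\<close> it is the rank-one
  update.\<close>

lemma IAS_pivot_map:
  assumes "i \<in> verts G" "w \<in> verts G"
  shows "IAS (nonsimple_local_complement G v) i (pivot_map G v (w, k)) =
    IAS G i (w, k) + of_bool (i \<in> open_nbhd G v) * IAS G v (w, k)"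
proof (cases "w = v")
  case False
  then have "adjacency_matrix G v w = of_bool (w \<in> open_nbhd G v)"
    using assms by (simp add: open_nbhd_iff adjacency_matrix_def)
  with False show ?thesis
    by (cases k; cases "i \<in> open_nbhd G v"; cases "w \<in> open_nbhd G v")
      (simp_all add: pivot_map_def adjacency_matrix_nonsimple_local_complement
        identity_matrix_def)
next
  case True
  have "of_bool (i \<in> open_nbhd G v) = (if i = v then 0 else adjacency_matrix G i v)"
    using assms by (simp add: open_nbhd_iff adjacency_matrix_def insert_commute)
  moreover have "v \<notin> open_nbhd G v"
    by (simp add: open_nbhd_iff)
  moreover have "adjacency_matrix G v v = of_bool ({v} \<in> edges G)"
    by (simp add: adjacency_matrix_def)
  ultimately show ?thesis
    using True by (cases "{v} \<in> edges G"; cases k; cases "i = v")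
      (simp_all add: pivot_map_def pivot_kind_def identity_matrix_def
        adjacency_matrix_nonsimple_local_complement)
qed

lemma compatible_isomorphism_pivot_map:
  assumes "v \<in> verts G"
  shows "compatible_isomorphism G (nonsimple_local_complement G v) (pivot_map G v)"
proof -
  let ?H = "nonsimple_local_complement G v" and ?N = "open_nbhd G v"
  let ?p = "\<lambda>w. if w = v then transpose Phi (pivot_kind G v) else id"
  have "compatible_isomorphism G ?H (\<lambda>e. (id (fst e), ?p (fst e) (snd e)))"
  proof (rule compatible_isomorphismI)
    fix c :: "'a \<times> column_kind \<Rightarrow> bit" and X assume X: "X \<subseteq> IAS_ground G"
    have row: "(\<Sum>e\<in>X. c e * IAS ?H i (pivot_map G v e)) =
        (\<Sum>e\<in>X. c e * IAS G i e) + of_bool (i \<in> ?N) * (\<Sum>e\<in>X. c e * IAS G v e)"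
      if "i \<in> verts G" for i
    proof -
      have "(\<Sum>e\<in>X. c e * IAS ?H i (pivot_map G v e)) =
          (\<Sum>e\<in>X. c e * IAS G i e + of_bool (i \<in> ?N) * (c e * IAS G v e))"
        using X that by (intro sum.cong) (auto simp: IAS_ground_eq IAS_pivot_map algebra_simps)
      then show ?thesis
        by (simp only: sum.distrib sum_distrib_left)
    qed
    \<comment> \<open>Row \<open>v\<close> is not changed, since \<open>v\<close> is not its own
      neighbor. Once its equation holds, the terms added to the other rows vanish, so both systems
      have the same solutions.\<close>
    have "(\<Sum>e\<in>X. c e * IAS ?H v (pivot_map G v e)) = (\<Sum>e\<in>X. c e * IAS G v e)"
      unfolding row[OF assms] by (simp only: open_nbhd_iff) simp
    then have "(\<forall>i\<in>verts G. (\<Sum>e\<in>X. c e * IAS ?H i (pivot_map G v e)) = 0) \<longrightarrow>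
        (\<Sum>e\<in>X. c e * IAS G v e) = 0"
      using assms by metis
    then have "(\<forall>i\<in>verts G. (\<Sum>e\<in>X. c e * IAS G i e) = 0) \<longleftrightarrow>
        (\<forall>i\<in>verts G. (\<Sum>e\<in>X. c e * IAS ?H i (pivot_map G v e)) = 0)"
      using assms by (simp only: row mult_zero_right add_0_right cong: ball_cong) auto
    then show "(\<forall>i\<in>verts G. (\<Sum>e\<in>X. c e * IAS G i e) = 0) \<longleftrightarrow>
        (\<forall>i\<in>verts ?H. (\<Sum>e\<in>X. c e * IAS ?H i (id (fst e), ?p (fst e) (snd e))) = 0)"
      by (simp add: pivot_map_def)
  qed (auto simp: bij_betw_id[unfolded id_def] bij_id[unfolded id_def])
  then show ?thesis
    by (simp add: pivot_map_def[abs_def])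
qed

lemma obtainable_imp_compatible_isomorphism:
  "obtainable G H \<Longrightarrow> \<exists>\<beta>. compatible_isomorphism G H \<beta>"
proof (induction rule: obtainable.induct)
  case obtainable_refl
  show ?case by (rule compatible_isomorphism_off_diagonal[of id]) auto
next
  case (obtainable_loop H v)
  have "\<exists>\<beta>. compatible_isomorphism H (loop_complement H v) \<beta>"
    by (rule compatible_isomorphism_off_diagonal[of id]) (auto simp: edge_loop_complement)
  with obtainable_loop.IH show ?case by (blast intro: compatible_isomorphism_trans)
next
  case (obtainable_simple H v)
  \<comment> \<open>The two local complements differ only in loops.\<close>
  have "\<exists>\<beta>. compatible_isomorphism (nonsimple_local_complement H v)
      (simple_local_complement H v) \<beta>"
    by (rule compatible_isomorphism_off_diagonal[of id]) (auto simp: edge_simple_local_complement)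
  with obtainable_simple show ?case
    by (blast intro: compatible_isomorphism_trans compatible_isomorphism_pivot_map)
next
  case (obtainable_nonsimple H v)
  then show ?case
    by (blast intro: compatible_isomorphism_trans compatible_isomorphism_pivot_map)
qed

section \<open>Graph operations from compatible isomorphisms\<close>

text \<open>Cells are disjoint and \<beta> is bijective, so distinct cells have distinct images and
  every cell of \<open>H\<close> is reached.\<close>

lemma compatible_isomorphism_vertex_map:
  assumes "compatible_isomorphism G H \<beta>"
  obtains f where "bij_betw f (verts G) (verts H)"
    and "\<And>v. v \<in> verts G \<Longrightarrow> \<beta> ` ({v} \<times> UNIV) = {f v} \<times> UNIV"
proof -
  have bij: "bij_betw \<beta> (verts G \<times> UNIV) (verts H \<times> UNIV)"
    using assms by (simp add: compatible_isomorphism_def matroid_isomorphism_def IAS_matroid_def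
        represented_matroid_def IAS_ground_eq)
  have "\<forall>v\<in>verts G. \<exists>w\<in>verts H. \<beta> ` ({v} \<times> UNIV) = {w} \<times> UNIV"
    using assms by (simp add: compatible_isomorphism_def canonical_partition_eq image_iff)
  from bchoice[OF this[unfolded Bex_def]] obtain f
    where *: "\<forall>v\<in>verts G. f v \<in> verts H \<and> \<beta> ` ({v} \<times> UNIV) = {f v} \<times> UNIV" ..
  then have f: "f v \<in> verts H" and cell: "\<beta> ` ({v} \<times> UNIV) = {f v} \<times> UNIV"
    if "v \<in> verts G" for v
    by (rule conjunct1[OF bspec[OF _ that]], rule conjunct2[OF bspec[OF _ that]])
  have "inj_on f (verts G)"
  proof (rule inj_onI)
    fix v w assume vw: "v \<in> verts G" "w \<in> verts G" "f v = f w"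
    then have "\<beta> ` ({v} \<times> UNIV) = \<beta> ` ({w} \<times> UNIV)"
      by (simp only: cell)
    then obtain k where "\<beta> (v, Phi) = \<beta> (w, k)"
      by blast
    from inj_onD[OF bij_betw_imp_inj_on[OF bij] this] vw show "v = w"
      by simp
  qed
  moreover have "verts H \<subseteq> f ` verts G"
  proof
    fix w assume "w \<in> verts H"
    then have "(w, Phi) \<in> \<beta> ` (verts G \<times> UNIV)"
      unfolding bij_betw_imp_surj_on[OF bij] by simp
    then obtain v k where v: "v \<in> verts G" "(w, Phi) = \<beta> (v, k)"
      by blast
    then have "(w, Phi) \<in> \<beta> ` ({v} \<times> UNIV)"
      by simp
    with cell[OF v(1)] v(1) show "w \<in> f ` verts G"
      by (simp)
  qed
  ultimately have "bij_betw f (verts G) (verts H)"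
    using f by (auto simp: bij_betw_def)
  from this cell show thesis by (rule that)
qed

lemma compatible_isomorphism_independent:
  assumes "compatible_isomorphism G H \<beta>" "X \<subseteq> verts G \<times> UNIV"
  shows "columns_independent (verts G) (IAS G) X \<longleftrightarrow>
    columns_independent (verts H) (IAS H) (\<beta> ` X)"
proof -
  have "\<beta> ` X \<subseteq> IAS_ground H"
    using assms by (auto simp: compatible_isomorphism_def matroid_isomorphism_def IAS_matroid_def
        represented_matroid_def IAS_ground_eq bij_betw_def)
  then show ?thesis
    using assms by (auto simp: compatible_isomorphism_def matroid_isomorphism_def IAS_matroid_def
        represented_matroid_def IAS_ground_eq)
qed

section \<open>Independence of \<open>Phi\<close> columns together with one further column\<close>

lemma columns_independent_Phi:
  assumes "finite U" "U \<subseteq> verts G"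
  shows "columns_independent (verts G) (IAS G) (U \<times> {Phi})"
  unfolding columns_independent_def
proof (intro allI impI ballI)
  fix c e assume *: "\<forall>i\<in>verts G. (\<Sum>e\<in>U \<times> {Phi}. c e * IAS G i e) = 0" and "e \<in> U \<times> {Phi}"
  then obtain u where u: "u \<in> U" "e = (u, Phi)"
    by auto
  have "(\<Sum>e\<in>U \<times> {Phi}. c e * IAS G u e) = (\<Sum>e\<in>{(u, Phi)}. c e * IAS G u e)"
    using assms u by (intro sum.mono_neutral_right) (auto simp: identity_matrix_def)
  also have "\<dots> = c e"
    using u by (simp add: identity_matrix_def del: mult_bit_eq_and)
  finally show "c e = 0"
    using * u assms by (metis subsetD)
qed

text \<open>Modulo the unit vectors indexed by \<open>U\<close>, only the rows outside
  \<open>U\<close> of the extra column remain. A suitable \<open>U\<close> thus lets the matroid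
  reveal single matrix entries.\<close>

lemma columns_independent_insert_Phi:
  assumes U: "finite U" "U \<subseteq> verts G" and k: "k \<noteq> Phi"
  shows "columns_independent (verts G) (IAS G) (insert (v, k) (U \<times> {Phi})) \<longleftrightarrow>
    (\<exists>i\<in>verts G - U. IAS G i (v, k) \<noteq> 0)"
proof -
  have row: "(\<Sum>e\<in>insert (v, k) (U \<times> {Phi}). c e * IAS G i e) =
      c (v, k) * IAS G i (v, k) + (if i \<in> U then c (i, Phi) else 0)" for c i
  proof -
    have "(\<Sum>e\<in>U \<times> {Phi}. c e * IAS G i e) = (\<Sum>u\<in>U. c (u, Phi) * IAS G i (u, Phi))"
      by (rule sum.reindex_bij_witness[of _ "\<lambda>u. (u, Phi)" fst]) auto
    also have "\<dots> = (\<Sum>u\<in>U. if i = u then c (u, Phi) else 0)"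
      by (intro sum.cong) (auto simp: identity_matrix_def simp del: mult_bit_eq_and)
    also have "\<dots> = (if i \<in> U then c (i, Phi) else 0)"
      using U by simp
    finally show ?thesis
      using U k by (subst sum.insert) auto
  qed
  show ?thesis
  proof
    assume ind: "columns_independent (verts G) (IAS G) (insert (v, k) (U \<times> {Phi}))"
    show "\<exists>i\<in>verts G - U. IAS G i (v, k) \<noteq> 0"
    proof (rule ccontr)
      assume "\<not> ?thesis"
      then have z: "\<And>i. i \<in> verts G \<Longrightarrow> i \<notin> U \<Longrightarrow> IAS G i (v, k) = 0"
        by blast
      \<comment> \<open>The extra column is then the sum of the unit vectors at its nonzero rows. In
        each row of \<open>U\<close> two equal terms cancel in characteristic 2.\<close>
      define c where "c e = (if e = (v, k) then 1 else IAS G (fst e) (v, k))" for e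
      have "\<forall>i\<in>verts G. (\<Sum>e\<in>insert (v, k) (U \<times> {Phi}). c e * IAS G i e) = 0"
        using z k unfolding row by (auto simp: c_def)
      then have "c (v, k) = 0"
        using ind unfolding columns_independent_def by blast
      then show False
        by (simp add: c_def)
    qed
  next
    assume "\<exists>i\<in>verts G - U. IAS G i (v, k) \<noteq> 0"
    then obtain j where j: "j \<in> verts G" "j \<notin> U" "IAS G j (v, k) \<noteq> 0"
      by blast
    show "columns_independent (verts G) (IAS G) (insert (v, k) (U \<times> {Phi}))"
      unfolding columns_independent_def row
    proof (intro allI impI ballI)
      fix c e assume c: "\<forall>i\<in>verts G. c (v, k) * IAS G i (v, k) + (if i \<in> U then c (i, Phi) else 0) = 0"
        and e: "e \<in> insert (v, k) (U \<times> {Phi})"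
      have "c (v, k) = 0"
        using bspec[OF c j(1)] j by simp
      then show "c e = 0"
        using bspec[OF c, of "fst e"] e U by auto
    qed
  qed
qed

section \<open>Reducing the set of displaced vertices\<close>

text \<open>The set \<open>D\<close> of the proof idea above.\<close>

definition displaced :: "'a looped_graph \<Rightarrow> ('a \<Rightarrow> 'b) \<Rightarrow>
    ('a \<times> column_kind \<Rightarrow> 'b \<times> column_kind) \<Rightarrow> 'a set" where
  "displaced G f \<beta> = {v \<in> verts G. \<beta> (v, Phi) \<noteq> (f v, Phi)}"

text \<open>Recording \<open>f\<close> explicitly allows one vertex map to be kept while
  \<open>G\<close> and \<beta> change.\<close>

definition cellwise :: "'a looped_graph \<Rightarrow> ('a \<Rightarrow> 'b) \<Rightarrow>
    ('a \<times> column_kind \<Rightarrow> 'b \<times> column_kind) \<Rightarrow> bool" where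
  "cellwise G f \<beta> \<longleftrightarrow> (\<forall>v\<in>verts G. \<beta> ` ({v} \<times> UNIV) = {f v} \<times> UNIV)"

lemma pivot_nonsimple_local_complement:
  "pivot_kind (nonsimple_local_complement G v) v = pivot_kind G v"
  "pivot_map (nonsimple_local_complement G v) v = pivot_map G v"
proof -
  show "pivot_kind (nonsimple_local_complement G v) v = pivot_kind G v"
    using edge_nonsimple_local_complement[of v v G v]
    by (simp add: pivot_kind_def open_nbhd_iff)
  then show "pivot_map (nonsimple_local_complement G v) v = pivot_map G v"
    by (simp add: pivot_map_def fun_eq_iff)
qed

text \<open>By involution, the pivot map also leads from the local complement back to
  \<open>G\<close>, so it can be followed by \<beta>.\<close>

lemma compatible_isomorphism_comp_pivot_map:
  assumes "v \<in> verts G" "compatible_isomorphism G H \<beta>"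
  shows "compatible_isomorphism (nonsimple_local_complement G v) H (\<beta> \<circ> pivot_map G v)"
  using compatible_isomorphism_pivot_map[of v "nonsimple_local_complement G v"] assms
  by (auto simp: nonsimple_local_complement_involution pivot_nonsimple_local_complement
      intro: compatible_isomorphism_trans)

lemma cellwise_comp_pivot_map:
  assumes "cellwise G f \<beta>"
  shows "cellwise (nonsimple_local_complement G v) f (\<beta> \<circ> pivot_map G v)"
proof -
  have "pivot_map G v ` ({w} \<times> UNIV) = {w} \<times> UNIV" for w
  proof -
    have "pivot_map G v ` ({w} \<times> UNIV) =
        {w} \<times> range (if w = v then transpose Phi (pivot_kind G v) else id)"
      by (auto simp: pivot_map_def image_iff) (metis transpose_involutory)
    then show ?thesis
      by simp
  qed
  then show ?thesis
    using assms unfolding cellwise_def image_comp[symmetric] by simp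
qed

lemma displaced_comp_pivot_map:
  assumes "v \<in> displaced G f \<beta>" "\<beta> (v, pivot_kind G v) = (f v, Phi)"
  shows "displaced (nonsimple_local_complement G v) f (\<beta> \<circ> pivot_map G v) \<subset> displaced G f \<beta>"
  using assms by (auto simp: displaced_def pivot_map_def)

lemma ex_displaced_smaller:
  assumes G: "finite (verts G)" and \<beta>: "compatible_isomorphism G H \<beta>" "cellwise G f \<beta>"
    and f: "bij_betw f (verts G) (verts H)" and ne: "displaced G f \<beta> \<noteq> {}"
  shows "\<exists>G' \<beta>'. obtainable G G' \<and> compatible_isomorphism G' H \<beta>' \<and> cellwise G' f \<beta>' \<and>
    verts G' = verts G \<and> displaced G' f \<beta>' \<subset> displaced G f \<beta>"
proof (cases "\<exists>v\<in>displaced G f \<beta>. \<beta> (v, pivot_kind G v) = (f v, Phi)")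
  case True
  then obtain v where v: "v \<in> displaced G f \<beta>" "\<beta> (v, pivot_kind G v) = (f v, Phi)"
    by blast
  then have "v \<in> verts G"
    by (simp add: displaced_def)
  then show ?thesis
    using v \<beta> by (intro exI[of _ "nonsimple_local_complement G v"] exI[of _ "\<beta> \<circ> pivot_map G v"])
      (simp add: obtainable_nonsimple obtainable_refl compatible_isomorphism_comp_pivot_map
        cellwise_comp_pivot_map displaced_comp_pivot_map)
next
  case False
  let ?D = "displaced G f \<beta>"
  have D: "?D \<subseteq> verts G"
    by (auto simp: displaced_def)
  from ne obtain v where v: "v \<in> ?D"
    by blast
  \<comment> \<open>What remains is the third kind, whose column has entry 0 in row
    \<open>u\<close>.\<close>
  have tau: "\<exists>k. \<beta> (u, k) = (f u, Phi) \<and> k \<noteq> Phi \<and> k \<noteq> pivot_kind G u" if u: "u \<in> ?D" for u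
  proof -
    have "(f u, Phi) \<in> \<beta> ` ({u} \<times> UNIV)"
      using \<beta>(2) u D by (auto simp: cellwise_def)
    then obtain k where "\<beta> (u, k) = (f u, Phi)"
      by auto
    then show ?thesis
      using u False by (auto simp: displaced_def)
  qed
  from tau[OF v] obtain k where k: "\<beta> (v, k) = (f v, Phi)" "k \<noteq> Phi" "k \<noteq> pivot_kind G v"
    by blast
  \<comment> \<open>The chosen set goes to \<open>Phi\<close> columns of \<open>H\<close>, hence is
    independent. Its own \<open>Phi\<close> columns cover all rows outside \<open>?D\<close>, which
    forces a nonzero entry of column \<open>(v, k)\<close> in a row \<open>w\<close> of
    \<open>?D\<close>.\<close>
  have "\<beta> ` insert (v, k) ((verts G - ?D) \<times> {Phi}) = (\<lambda>u. (f u, Phi)) ` insert v (verts G - ?D)"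
    using k(1) by (force simp: displaced_def)
  also have "\<dots> = f ` insert v (verts G - ?D) \<times> {Phi}"
    by auto
  finally have image: "\<beta> ` insert (v, k) ((verts G - ?D) \<times> {Phi}) =
      f ` insert v (verts G - ?D) \<times> {Phi}" .
  have "columns_independent (verts H) (IAS H) (\<beta> ` insert (v, k) ((verts G - ?D) \<times> {Phi}))"
    unfolding image using G f v D by (intro columns_independent_Phi) (auto simp: bij_betw_def)
  then have "columns_independent (verts G) (IAS G) (insert (v, k) ((verts G - ?D) \<times> {Phi}))"
    using v D by (subst compatible_isomorphism_independent[OF \<beta>(1)]) auto
  then have "\<exists>i\<in>verts G - (verts G - ?D). IAS G i (v, k) \<noteq> 0"
    using G k(2) by (subst (asm) columns_independent_insert_Phi) auto
  then obtain w where w: "w \<in> ?D" "IAS G w (v, k) \<noteq> 0"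
    by blast
  have "IAS G v (v, k) = 0"
    using k by (cases k) (auto simp: pivot_kind_def adjacency_matrix_def identity_matrix_def
        split: if_splits)
  with w have "w \<noteq> v"
    by auto
  moreover have "adjacency_matrix G w v \<noteq> 0"
    using w k \<open>w \<noteq> v\<close> by (cases k) (auto simp: identity_matrix_def)
  ultimately have wN: "w \<in> open_nbhd G v"
    using w(1) D by (auto simp: open_nbhd_iff adjacency_matrix_def insert_commute)
  let ?G = "nonsimple_local_complement G v" and ?\<beta> = "\<beta> \<circ> pivot_map G v"
  \<comment> \<open>Complementing at the neighbor \<open>v\<close> reverses the loop at
    \<open>w\<close>, which makes the preimage column \<open>l\<close> the pivot of
    \<open>w\<close>.\<close>
  have "{w} \<in> edges ?G \<longleftrightarrow> {w} \<notin> edges G"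
    using edge_nonsimple_local_complement[of w w G v] wN by simp
  moreover from tau[OF w(1)] obtain l
    where l: "\<beta> (w, l) = (f w, Phi)" "l \<noteq> Phi" "l \<noteq> pivot_kind G w"
    by blast
  ultimately have "pivot_kind ?G w = l"
    by (cases l) (auto simp: pivot_kind_def split: if_splits)
  then have "?\<beta> (w, pivot_kind ?G w) = (f w, Phi)"
    using l \<open>w \<noteq> v\<close> by (simp add: pivot_map_def)
  moreover have "w \<in> displaced ?G f ?\<beta>"
    using w(1) \<open>w \<noteq> v\<close> by (simp add: displaced_def pivot_map_def)
  ultimately have "displaced (nonsimple_local_complement ?G w) f (?\<beta> \<circ> pivot_map ?G w)
      \<subset> displaced ?G f ?\<beta>"
    by (intro displaced_comp_pivot_map)
  \<comment> \<open>The first complementation alters the map only on the cell of \<open>v\<close>,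
    which is already displaced; the strict decrease comes from \<open>w\<close>.\<close>
  moreover have "displaced ?G f ?\<beta> \<subseteq> ?D"
    using v by (auto simp: displaced_def pivot_map_def)
  moreover have "obtainable G (nonsimple_local_complement ?G w)"
    using v w D by (intro obtainable_nonsimple obtainable_refl) auto
  ultimately show ?thesis
    using v w D \<beta>
    by (intro exI[of _ "nonsimple_local_complement ?G w"] exI[of _ "?\<beta> \<circ> pivot_map ?G w"])
      (auto simp del: comp_apply intro!: compatible_isomorphism_comp_pivot_map cellwise_comp_pivot_map)
qed

lemma ex_displaced_empty:
  assumes "finite (verts G)" "compatible_isomorphism G H \<beta>" "cellwise G f \<beta>"
    "bij_betw f (verts G) (verts H)"
  shows "\<exists>G' \<beta>'. obtainable G G' \<and> compatible_isomorphism G' H \<beta>' \<and> cellwise G' f \<beta>' \<and>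
    verts G' = verts G \<and> displaced G' f \<beta>' = {}"
  using assms
proof (induction "card (displaced G f \<beta>)" arbitrary: G \<beta> rule: less_induct)
  case less
  show ?case
  proof (cases "displaced G f \<beta> = {}")
    case True
    then show ?thesis
      using less.prems obtainable_refl by blast
  next
    case False
    then obtain G' \<beta>' where step: "obtainable G G'" "compatible_isomorphism G' H \<beta>'"
      "cellwise G' f \<beta>'" "verts G' = verts G" "displaced G' f \<beta>' \<subset> displaced G f \<beta>"
      using ex_displaced_smaller[OF less.prems] by blast
    moreover have "finite (displaced G f \<beta>)"
      using less.prems(1) by (simp add: displaced_def)
    ultimately have "card (displaced G' f \<beta>') < card (displaced G f \<beta>)"
      by (intro psubset_card_mono)
    from less.hyps[OF this] step less.prems show ?thesis
      by (metis obtainable_trans)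
  qed
qed

text \<open>With the \<open>Phi\<close> columns of all vertices but \<open>w\<close>, independence
  of \<open>(v, Chi)\<close> tests its entry in row \<open>w\<close>. Its image may be the
  \<open>Chi\<close> or the \<open>Psi\<close> column of \<open>f v\<close>, but these agree off the
  diagonal.\<close>

lemma displaced_empty_imp_adjacent_iff:
  assumes G: "finite (verts G)" and \<beta>: "compatible_isomorphism G H \<beta>" "cellwise G f \<beta>"
    and f: "bij_betw f (verts G) (verts H)" and D: "displaced G f \<beta> = {}"
    and vw: "v \<in> verts G" "w \<in> verts G" "v \<noteq> w"
  shows "{v, w} \<in> edges G \<longleftrightarrow> {f v, f w} \<in> edges H"
proof -
  have Phi: "\<beta> (u, Phi) = (f u, Phi)" if "u \<in> verts G" for u
    using D that by (auto simp: displaced_def)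
  have "\<beta> (v, Chi) \<in> \<beta> ` ({v} \<times> UNIV)"
    by simp
  also have "\<dots> = {f v} \<times> UNIV"
    using \<beta>(2) vw(1) by (simp add: cellwise_def)
  finally obtain k where k: "\<beta> (v, Chi) = (f v, k)"
    by auto
  have "inj_on \<beta> (verts G \<times> UNIV)"
    using \<beta>(1) by (simp add: compatible_isomorphism_def matroid_isomorphism_def IAS_matroid_def
        represented_matroid_def IAS_ground_eq bij_betw_def)
  then have "k \<noteq> Phi"
    using k Phi[OF vw(1)] vw(1) by (auto dest: inj_onD[of _ _ "(v, Chi)" "(v, Phi)"])
  have fvw: "f v \<noteq> f w" "f v \<in> verts H" "f w \<in> verts H"
    using f vw by (auto simp: bij_betw_def inj_on_def)
  have U: "f ` (verts G - {w}) = verts H - {f w}"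
    using f vw by (auto simp: bij_betw_def inj_on_def)
  have "\<beta> ` insert (v, Chi) ((verts G - {w}) \<times> {Phi}) =
      insert (f v, k) ((\<lambda>u. (f u, Phi)) ` (verts G - {w}))"
    using k Phi by force
  also have "\<dots> = insert (f v, k) (f ` (verts G - {w}) \<times> {Phi})"
    by auto
  finally have "columns_independent (verts G) (IAS G) (insert (v, Chi) ((verts G - {w}) \<times> {Phi}))
      \<longleftrightarrow> columns_independent (verts H) (IAS H) (insert (f v, k) ((verts H - {f w}) \<times> {Phi}))"
    using vw U by (subst compatible_isomorphism_independent[OF \<beta>(1)]) auto
  moreover have "finite (verts H)"
    using f G bij_betw_finite by blast
  ultimately have "IAS G w (v, Chi) \<noteq> 0 \<longleftrightarrow> IAS H (f w) (f v, k) \<noteq> 0"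
    using G vw fvw \<open>k \<noteq> Phi\<close> by (simp add: columns_independent_insert_Phi Diff_Diff_Int del: IAS.simps)
  then show ?thesis
    using fvw \<open>k \<noteq> Phi\<close>
    by (cases k) (auto simp: adjacency_matrix_def identity_matrix_def insert_commute split: if_splits)
qed

lemma isomorphic_up_to_loops:
  assumes G: "finite (verts G)" and f: "bij_betw f (verts G) (verts H)"
    and adj: "\<And>v w. v \<in> verts G \<Longrightarrow> w \<in> verts G \<Longrightarrow> v \<noteq> w \<Longrightarrow>
      {v, w} \<in> edges G \<longleftrightarrow> {f v, f w} \<in> edges H"
  shows "\<exists>K. obtainable G K \<and> isomorphic_graphs K H"
proof -
  \<comment> \<open>Loop complementation exactly at these vertices makes \<open>f\<close> an
    isomorphism.\<close>
  define S where "S = {v \<in> verts G. ({v} \<in> edges G) \<noteq> ({f v} \<in> edges H)}"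
  let ?K = "G\<lparr>edges := sym_diff (edges G) {{v} | v. v \<in> S}\<rparr>"
  have "{v, w} \<in> edges ?K \<longleftrightarrow> {f v, f w} \<in> edges H" if "v \<in> verts G" "w \<in> verts G" for v w
    using that adj[of v w] by (cases "v = w") (auto simp: S_def doubleton_eq_iff)
  then have "graph_isomorphism ?K H f"
    using f by (simp add: graph_isomorphism_def)
  moreover have "obtainable G ?K"
    using G by (intro obtainable_loop_complements) (auto simp: S_def)
  ultimately show ?thesis
    unfolding isomorphic_graphs_def by blast
qed

theorem theorem17:
  fixes G1 :: "'a looped_graph" and G2 :: "'b looped_graph"
  assumes "looped_simple_graph G1" and "looped_simple_graph G2"
  shows "(\<exists>H. obtainable G1 H \<and> isomorphic_graphs H G2) \<longleftrightarrow>
    (\<exists>\<beta>. compatible_isomorphism G1 G2 \<beta>)"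
proof
  assume "\<exists>H. obtainable G1 H \<and> isomorphic_graphs H G2"
  then obtain H f where H: "obtainable G1 H" and f: "graph_isomorphism H G2 f"
    unfolding isomorphic_graphs_def by blast
  have "\<exists>\<beta>. compatible_isomorphism H G2 \<beta>"
    using f by (intro compatible_isomorphism_off_diagonal) (auto simp: graph_isomorphism_def)
  with obtainable_imp_compatible_isomorphism[OF H]
  show "\<exists>\<beta>. compatible_isomorphism G1 G2 \<beta>"
    by (blast intro: compatible_isomorphism_trans)
next
  assume "\<exists>\<beta>. compatible_isomorphism G1 G2 \<beta>"
  then obtain \<beta> where \<beta>: "compatible_isomorphism G1 G2 \<beta>" ..
  obtain f where f: "bij_betw f (verts G1) (verts G2)" and cell: "cellwise G1 f \<beta>"
    using compatible_isomorphism_vertex_map[OF \<beta>] unfolding cellwise_def by metis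
  have fin: "finite (verts G1)"
    using assms(1) by (rule looped_simple_graph.finite_verts)
  obtain G' \<beta>' where G': "obtainable G1 G'" "compatible_isomorphism G' G2 \<beta>'" "cellwise G' f \<beta>'"
    "verts G' = verts G1" "displaced G' f \<beta>' = {}"
    using ex_displaced_empty[OF fin \<beta> cell f] by blast
  have "\<exists>K. obtainable G' K \<and> isomorphic_graphs K G2"
    using G' fin f displaced_empty_imp_adjacent_iff[of G' G2 \<beta>' f]
    by (intro isomorphic_up_to_loops[of G' f]) auto
  then show "\<exists>H. obtainable G1 H \<and> isomorphic_graphs H G2"
    using G'(1) obtainable_trans by blast
qed

end
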